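(* Let $G$ be a highly symmetric graph. Then the following hold. (i) If every vertex of $G$ is resistance regular, then $G$ is regular. (ii) $G$ does not have a resistance-regular cut-vertex. (iii) If $G$ has a cut-edge, then the two components that result from removing this edge have the same number of edges. (iv) $G$ does not contain two (distinct) cut-edges.
   Context: All graphs are finite, simple, connected and undirected. The simple random walk $(X_n)$ on a graph jumps from a vertex to a uniformly chosen neighbor. The hitting time of a vertex $b$ is $T_b=\inf\{n\ge 0: X_n=b\}$, and $E_aT_b$ denotes its expectation when the walk starts at $a$. A graph is highly symmetric if $E_aT_b=E_bT_a$ for all vertices $a,b$. $R_{ij}$ denotes the effective resistance between vertices $i$ and $j$ when the graph is viewed as an electric network with a unit resistor on each edge. A vertex $i$ of a graph is resistance regular if $R_{ij}=R_{ik}$ for any vertices $j,k$ adjacent to $i$. A cut-vertex (respectively cut-edge) of a connected graph is a vertex (respectively edge) whose removal disconnects the graph; when a cut-edge is removed, its endpoints are kept. *)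

theory Defs
  imports "HOL-Probability.Probability" "Graph_Theory.Digraph_Component"
begin

text \<open>
  A finite simple undirected graph is a \<^term>\<open>graph\<close> in the sense of the imported library: a
  finite symmetric digraph without loops and parallel arcs. An undirected edge thus corresponds to
  two opposite arcs, and is represented below by the set of its two endpoints.
\<close>

definition edges :: "('a, 'b) pre_digraph \<Rightarrow> 'a set set" where
  "edges G = (\<lambda>e. {tail G e, head G e}) ` arcs G"

definition neighbours :: "('a, 'b) pre_digraph \<Rightarrow> 'a \<Rightarrow> 'a set" where
  "neighbours G v = {w. (v, w) \<in> arcs_ends G}"

definition regular :: "('a, 'b) pre_digraph \<Rightarrow> bool" where
  "regular G \<longleftrightarrow> (\<exists>d. \<forall>v\<in>verts G. card (neighbours G v) = d)"


subsection \<open>Simple random walk and hitting times\<close>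

definition walk_step :: "('a, 'b) pre_digraph \<Rightarrow> 'a \<Rightarrow> 'a measure" where
  "walk_step G v = uniform_measure (count_space (verts G)) (neighbours G v)"

definition walk_kernel :: "('a, 'b) pre_digraph \<Rightarrow> 'a \<Rightarrow> nat \<Rightarrow> (nat \<Rightarrow> 'a) \<Rightarrow> 'a measure" where
  "walk_kernel G a n X =
    (case n of 0 \<Rightarrow> return (count_space (verts G)) a | Suc m \<Rightarrow> walk_step G (X m))"

text \<open>
  The law of the walk started at \<open>a\<close>, on the space of all vertex sequences, is the
  Ionescu--Tulcea limit of these kernels; its finite-dimensional distributions are computed in
  \<open>emeasure_random_walk\<close> below. On the one-vertex graph the walk has nowhere to jump and the
  definition carries no meaning, but there it is only ever used to compare \<open>E\<^sub>a T\<^sub>a\<close> with itself.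
\<close>

definition random_walk :: "('a, 'b) pre_digraph \<Rightarrow> 'a \<Rightarrow> (nat \<Rightarrow> 'a) measure" where
  "random_walk G a = projective_family.lim UNIV
     (Ionescu_Tulcea.CI (walk_kernel G a) (\<lambda>_. count_space (verts G)))
     (\<lambda>_. count_space (verts G))"

definition hitting_time :: "'a \<Rightarrow> (nat \<Rightarrow> 'a) \<Rightarrow> enat" where
  "hitting_time b X = (INF n\<in>{n. X n = b}. enat n)"

definition expected_hitting_time :: "('a, 'b) pre_digraph \<Rightarrow> 'a \<Rightarrow> 'a \<Rightarrow> ennreal" where
  "expected_hitting_time G a b =
    (\<integral>\<^sup>+X. ennreal_of_enat (hitting_time b X) \<partial>random_walk G a)"

definition highly_symmetric :: "('a, 'b) pre_digraph \<Rightarrow> bool" where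
  "highly_symmetric G \<longleftrightarrow>
    (\<forall>a\<in>verts G. \<forall>b\<in>verts G. expected_hitting_time G a b = expected_hitting_time G b a)"


subsection \<open>Effective resistance\<close>

text \<open>
  By Ohm's law with unit resistances, a potential \<open>h\<close> drives the current \<open>h x - h y\<close> along the edge
  from \<open>x\<close> to \<open>y\<close>. Kirchhoff's law for a unit current entering at \<open>i\<close> and leaving at \<open>j\<close> then
  reads as follows. On a connected graph such an \<open>h\<close> exists and is unique up to an additive
  constant, so the resistance, i.e. voltage per unit current, is well defined.
\<close>

definition unit_current_potential ::
    "('a, 'b) pre_digraph \<Rightarrow> 'a \<Rightarrow> 'a \<Rightarrow> ('a \<Rightarrow> real) \<Rightarrow> bool" where
  "unit_current_potential G i j h \<longleftrightarrow>
    (\<forall>x\<in>verts G. (\<Sum>y\<in>neighbours G x. h x - h y) = of_bool (x = i) - of_bool (x = j))"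

definition effective_resistance :: "('a, 'b) pre_digraph \<Rightarrow> 'a \<Rightarrow> 'a \<Rightarrow> real" where
  "effective_resistance G i j = (THE r. \<exists>h. unit_current_potential G i j h \<and> r = h i - h j)"

definition resistance_regular :: "('a, 'b) pre_digraph \<Rightarrow> 'a \<Rightarrow> bool" where
  "resistance_regular G i \<longleftrightarrow> (\<forall>j\<in>neighbours G i. \<forall>k\<in>neighbours G i.
     effective_resistance G i j = effective_resistance G i k)"


subsection \<open>Cut-vertices and cut-edges\<close>

text \<open>
  The library predicate \<^term>\<open>Digraph_Component.connected\<close> is false on the graph without vertices,
  so the vertex of the one-vertex graph has to be excluded explicitly.
\<close>

definition cut_vertex :: "('a, 'b) pre_digraph \<Rightarrow> 'a \<Rightarrow> bool" where
  "cut_vertex G v \<longleftrightarrow> v \<in> verts G \<and> verts G \<noteq> {v} \<and>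
     \<not> Digraph_Component.connected (pre_digraph.del_vert G v)"

definition remove_edge :: "('a, 'b) pre_digraph \<Rightarrow> 'a set \<Rightarrow> ('a, 'b) pre_digraph" where
  "remove_edge G e = G\<lparr>arcs := {x \<in> arcs G. {tail G x, head G x} \<noteq> e}\<rparr>"

definition cut_edge :: "('a, 'b) pre_digraph \<Rightarrow> 'a set \<Rightarrow> bool" where
  "cut_edge G e \<longleftrightarrow> e \<in> edges G \<and> \<not> Digraph_Component.connected (remove_edge G e)"

text \<open>Since the graphs considered are symmetric, strong components are connected components.\<close>

abbreviation graph_components :: "('a, 'b) pre_digraph \<Rightarrow> ('a, 'b) pre_digraph set" where
  "graph_components \<equiv> pre_digraph.sccs"


subsection \<open>Finite-dimensional distributions of the walk\<close>

lemma (in graph) neighbours_subset: "neighbours G v \<subseteq> verts G"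
  by (auto simp: neighbours_def dest: adj_in_verts)

lemma (in graph) neighbours_nonempty:
  assumes "Digraph_Component.connected G" "v \<in> verts G" "verts G \<noteq> {v}"
  shows "neighbours G v \<noteq> {}"
proof -
  from assms(2,3) obtain w where w: "w \<in> verts G" "w \<noteq> v" by blast
  have "strongly_connected G"
    using assms(1) by (rule symmetric_connected_imp_strongly_connected[OF sym_arcs])
  then have "v \<rightarrow>\<^sup>*\<^bsub>G\<^esub> w"
    using w assms(2) by auto
  then obtain x where "(v, x) \<in> arcs_ends G"
    using w(2) by (cases rule: converse_reachable_cases) auto
  then show ?thesis by (auto simp: neighbours_def)
qed

lemma (in graph) prob_space_walk_step:
  assumes "neighbours G v \<noteq> {}"
  shows "prob_space (walk_step G v)"
  unfolding walk_step_def
proof (rule prob_space_uniform_measure)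
  have "finite (neighbours G v)" using neighbours_subset finite_verts by (rule finite_subset)
  then show "emeasure (count_space (verts G)) (neighbours G v) \<noteq> 0"
    and "emeasure (count_space (verts G)) (neighbours G v) \<noteq> \<infinity>"
    using assms neighbours_subset by (auto simp: emeasure_count_space_finite)
qed

lemma (in graph) Ionescu_Tulcea_walk_kernel:
  assumes "Digraph_Component.connected G" "a \<in> verts G" "verts G \<noteq> {a}"
  shows "Ionescu_Tulcea (walk_kernel G a) (\<lambda>_. count_space (verts G))"
proof -
  have ps: "prob_space (walk_step G v)" if "v \<in> verts G" for v
    using assms that by (intro prob_space_walk_step neighbours_nonempty) auto
  show ?thesis
  proof (rule Ionescu_Tulcea.intro)
    fix n :: nat
    show "walk_kernel G a n \<in> measurable (PiM {0..<n} (\<lambda>_. count_space (verts G)))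
            (subprob_algebra (count_space (verts G)))"
    proof (cases n)
      case 0
      then show ?thesis
        using assms by (auto simp: walk_kernel_def[abs_def] space_subprob_algebra
          intro!: measurable_const prob_space_imp_subprob_space prob_space_return)
    next
      case (Suc m)
      have "walk_step G \<in> measurable (count_space (verts G)) (subprob_algebra (count_space (verts G)))"
        using ps by (auto simp: space_subprob_algebra walk_step_def
          intro: prob_space_imp_subprob_space)
      moreover have "(\<lambda>X. X m) \<in> measurable (PiM {0..<n} (\<lambda>_. count_space (verts G)))
            (count_space (verts G))"
        by (rule measurable_component_singleton) (simp add: Suc)
      ultimately have "(\<lambda>X. walk_step G (X m)) \<in> measurable (PiM {0..<n} (\<lambda>_. count_space (verts G)))
            (subprob_algebra (count_space (verts G)))"
        by (rule measurable_compose[rotated])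
      then show ?thesis by (simp add: walk_kernel_def[abs_def] Suc)
    qed
  next
    fix n :: nat and X assume "X \<in> space (PiM {0..<n} (\<lambda>_. count_space (verts G)))"
    then show "prob_space (walk_kernel G a n X)"
      using assms(2) ps by (cases n) (auto simp: walk_kernel_def space_PiM PiE_iff
        intro!: prob_space_return)
  qed
qed

lemma (in graph) emeasure_random_walk:
  assumes "Digraph_Component.connected G" "a \<in> verts G" "verts G \<noteq> {a}"
    and x: "\<And>i. i \<le> n \<Longrightarrow> x i \<in> verts G"
  shows "emeasure (random_walk G a) {X \<in> space (random_walk G a). \<forall>i\<le>n. X i = x i} =
    of_bool (x 0 = a) *
    (\<Prod>i<n. of_bool (x (Suc i) \<in> neighbours G (x i)) / of_nat (card (neighbours G (x i))))"
proof -
  let ?V = "count_space (verts G)"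
  interpret IT: Ionescu_Tulcea "walk_kernel G a" "\<lambda>_. ?V"
    using assms(1-3) by (rule Ionescu_Tulcea_walk_kernel)
  let ?u = "\<lambda>_::nat. undefined :: 'a"
  let ?P = "\<lambda>m. PiM {0..<m} (\<lambda>_. ?V)"
  let ?x = "\<lambda>m. restrict x {0..<m}"
  have u: "?u \<in> space (?P 0)" by (simp add: space_PiM)
  have xP: "?x m \<in> space (?P m)" if "m \<le> Suc n" for m
    using that x by (auto simp: space_PiM)
  have sing: "{?x m} \<in> sets (?P m)" if "m \<le> Suc n" for m
  proof -
    have "PiE {0..<m} (\<lambda>i. {x i}) \<in> sets (?P m)"
      using that x by (intro sets_PiM_I_finite) auto
    also have "PiE {0..<m} (\<lambda>i. {x i}) = {?x m}"
      by (auto simp: PiE_iff extensional_def fun_eq_iff)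
    finally show ?thesis .
  qed
  have step: "emeasure (IT.C 0 (Suc m) ?u) {?x (Suc m)} =
      emeasure (IT.C 0 m ?u) {?x m} * emeasure (walk_kernel G a m (?x m)) {x m}"
    if m: "m \<le> n" for m
  proof -
    have eP: "emeasure (IT.eP m X) {?x (Suc m)} =
        emeasure (walk_kernel G a m (?x m)) {x m} * indicator {?x m} X"
      if X: "X \<in> space (?P m)" for X
    proof -
      have upd: "X(m := y) = ?x (Suc m) \<longleftrightarrow> X = ?x m \<and> y = x m" for y
      proof
        assume eq: "X(m := y) = ?x (Suc m)"
        have "X i = ?x m i" for i
          using fun_cong[OF eq, of i] X by (cases "i < m") (auto simp: space_PiM PiE_iff extensional_def)
        then show "X = ?x m \<and> y = x m"
          using fun_cong[OF eq, of m] by auto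
      qed (auto simp: fun_eq_iff less_Suc_eq)
      have "{y. Q \<and> y = z} \<inter> verts G = (if Q then {z} else {})" if "z \<in> verts G" for Q z
        using that by auto
      then have "(\<lambda>y. X(m := y)) -` {?x (Suc m)} \<inter> verts G = (if X = ?x m then {x m} else {})"
        unfolding vimage_def singleton_iff upd using x[OF m] by blast
      moreover have "emeasure (IT.eP m X) {?x (Suc m)} =
          emeasure (walk_kernel G a m X) ((\<lambda>y. X(m := y)) -` {?x (Suc m)} \<inter> verts G)"
        using IT.emeasure_eP[OF X sing[of "Suc m"]] m by simp
      ultimately show ?thesis
        by (cases "X = ?x m") simp_all
    qed
    have "emeasure (IT.C 0 (Suc m) ?u) {?x (Suc m)} =
        (\<integral>\<^sup>+X. emeasure (IT.eP m X) {?x (Suc m)} \<partial>IT.C 0 m ?u)"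
    proof -
      have "space (IT.C 0 m ?u) \<noteq> {}"
        using IT.prob_space_C[OF u, of m] by (rule prob_space.not_empty)
      moreover have "IT.eP m \<in> measurable (IT.C 0 m ?u) (subprob_algebra (?P (Suc m)))"
        using IT.measurable_eP[of m] IT.sets_C[OF u, of m]
        by (simp cong: measurable_cong_sets)
      ultimately show ?thesis
        using sing[of "Suc m"] m by (simp add: emeasure_bind)
    qed
    also have "\<dots> = (\<integral>\<^sup>+X. emeasure (walk_kernel G a m (?x m)) {x m} * indicator {?x m} X
        \<partial>IT.C 0 m ?u)"
      using eP IT.space_C[OF u, of m] by (intro nn_integral_cong) simp
    also have "\<dots> = emeasure (walk_kernel G a m (?x m)) {x m} * emeasure (IT.C 0 m ?u) {?x m}"
      using m sing[of m] by (intro nn_integral_cmult_indicator) (simp add: IT.sets_C[OF u])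
    finally show ?thesis by (simp add: mult.commute)
  qed
  have kernel0: "emeasure (walk_kernel G a 0 X) {x 0} = of_bool (x 0 = a)" for X
    using x[of 0] assms(2) by (auto simp: walk_kernel_def)
  have kernelS: "emeasure (walk_kernel G a (Suc m) (?x (Suc m))) {x (Suc m)} =
      of_bool (x (Suc m) \<in> neighbours G (x m)) / of_nat (card (neighbours G (x m)))"
    if "Suc m \<le> n" for m
  proof -
    have "finite (neighbours G (x m))" using neighbours_subset finite_verts by (rule finite_subset)
    then show ?thesis
      using x[of "Suc m"] that neighbours_subset[of "x m"]
      by (auto simp: walk_kernel_def walk_step_def emeasure_count_space_finite)
  qed
  have C: "emeasure (IT.C 0 (Suc m) ?u) {?x (Suc m)} = of_bool (x 0 = a) *
    (\<Prod>i<m. of_bool (x (Suc i) \<in> neighbours G (x i)) / of_nat (card (neighbours G (x i))))"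
    if "m \<le> n" for m
    using that
  proof (induction m)
    case 0
    have "emeasure (IT.C 0 0 ?u) {?x 0} = 1"
      using sing[of 0] by (simp add: restrict_def)
    then show ?case by (subst step) (simp_all add: kernel0 del: IT.C.simps)
  next
    case (Suc m)
    then show ?case
      by (simp only: step[OF Suc.prems] kernelS[OF Suc.prems] Suc.IH[OF Suc_leD[OF Suc.prems]]
        prod.lessThan_Suc mult.assoc)
  qed
  have rw: "random_walk G a = IT.PF.lim" by (simp add: random_walk_def)
  have "{X \<in> space (random_walk G a). \<forall>i\<le>n. X i = x i} = prod_emb UNIV (\<lambda>_. ?V) {0..<Suc n} {?x (Suc n)}"
    by (auto simp: rw prod_emb_def space_PiM fun_eq_iff restrict_def less_Suc_eq_le split: if_splits)
  then have "emeasure (random_walk G a) {X \<in> space (random_walk G a). \<forall>i\<le>n. X i = x i} =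
      emeasure (IT.CI {0..<Suc n}) {?x (Suc n)}"
    using sing[of "Suc n"] by (simp add: rw IT.lim)
  also have "\<dots> = emeasure (IT.C 0 (Suc n) ?u) {?x (Suc n)}"
  proof -
    have "IT.PF.emb {0..<Suc n} {0..<Suc n} {?x (Suc n)} = {?x (Suc n)}"
      using xP[of "Suc n"] by (intro prod_emb_id) (simp add: space_PiM)
    then show ?thesis
      using IT.emeasure_CI[OF order_refl sing[of "Suc n"]] by (simp del: IT.C.simps)
  qed
  finally show ?thesis using C[of n] by (simp del: IT.C.simps)
qed

end

theory Submission
  imports Defs
begin

text \<open>
  Write \<open>h\<^sub>b(x) = E\<^sub>x T\<^sub>b\<close>, let \<open>L\<close> be the graph Laplacian, \<open>(L f)(x) = \<Sum>\<^sub>y (f x - f y)\<close> over the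
  neighbours \<open>y\<close> of \<open>x\<close>, and let the volume of a vertex set be the sum of its degrees. Conditioning
  on the first step gives \<open>(L h\<^sub>b)(x) = deg x\<close> for \<open>x \<noteq> b\<close>, and since a Laplacian sums to zero, the
  value at \<open>b\<close> is \<open>deg b - vol V\<close> (lemma \<open>laplacian_hit\<close>). All parts follow from this equation.

  For regularity, \<open>(h\<^sub>b - h\<^sub>a) / vol V\<close> drives a unit current from \<open>a\<close> to \<open>b\<close>, so the resistance
  between \<open>a\<close> and \<open>b\<close> is the commute time divided by \<open>vol V\<close>. With symmetric hitting times it is
  therefore \<open>2 h\<^sub>b(a) / vol V\<close>, and resistance regularity at \<open>b\<close> means that \<open>h\<^sub>b\<close> is constant on the
  neighbours of \<open>b\<close>. The equation at \<open>b\<close> then reads \<open>deg b * (h\<^sub>b(y) + 1) = vol V\<close>. Exchanging the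
  roles of \<open>b\<close> and \<open>y\<close> shows that adjacent vertices have equal degrees.

  For the other parts, suppose that only the vertex \<open>v\<close> links \<open>A\<close> to the rest of the graph, and
  fix \<open>a \<in> A\<close>. Cut \<open>h\<^sub>v\<close> off outside \<open>A\<close>; because \<open>h\<^sub>v(v) = 0\<close>, the resulting \<open>u\<close> has Laplacian
  \<open>deg\<close> on \<open>A\<close>, \<open>- vol A\<close> at \<open>v\<close>, and zero elsewhere. Pair it with the potential
  \<open>g = h\<^sub>v - h\<^sub>a\<close>, which ranges between \<open>-t\<close> at \<open>v\<close> and \<open>t\<close> at \<open>a\<close>, where
  \<open>t = h\<^sub>v(a) = h\<^sub>a(v)\<close> by symmetry. Self-adjointness of \<open>L\<close> gives
  \<open>t * vol V = (\<Sum>x\<in>A. g x * deg x) + t * vol A \<le> 2 * t * vol A\<close>,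
  so \<open>A\<close> carries at least half of the volume (lemma \<open>vol_le_twice_side\<close>). Two sides of a cut-vertex
  cannot both do so, as \<open>v\<close> has volume of its own. Hence a highly symmetric graph has no cut-vertex.
  An endpoint of a cut-edge with a further neighbour would be a cut-vertex, so a graph with a
  cut-edge is a single edge, for which the claims on cut-edges are immediate.

  What remains is to derive the first-step equation, with finite values, from the law of the walk on
  sequences. The expectation of a hitting time is the sum over \<open>n\<close> of the probabilities of not having
  hit before time \<open>n + 1\<close>, and each of these is a finite sum of path probabilities
  (lemma \<open>emeasure_not_hit\<close>).
\<close>

section \<open>Connectedness and neighbourhoods\<close>

text \<open>The witness is the set of vertices reachable from a vertex that does not reach all others.\<close>

lemma (in sym_digraph) not_connectedE:
  assumes "\<not> Digraph_Component.connected G" "verts G \<noteq> {}"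
  obtains A where "A \<subseteq> verts G" "A \<noteq> {}" "A \<noteq> verts G" "\<And>x y. x \<in> A \<Longrightarrow> x \<rightarrow>\<^bsub>G\<^esub> y \<Longrightarrow> y \<in> A"
proof -
  obtain x y where xy: "x \<in> verts G" "y \<in> verts G" "\<not> x \<rightarrow>\<^sup>* y"
    using assms connectedI reachable_mk_symmetricI by blast
  show thesis
  proof (rule that[of "{z. x \<rightarrow>\<^sup>* z}"])
    show "{z. x \<rightarrow>\<^sup>* z} \<subseteq> verts G" by (auto elim: reachable_in_vertsE)
  qed (use xy in \<open>auto intro: reachable_adj_trans\<close>)
qed

text \<open>
  On the one-vertex graph there is no neighbour to jump to, so everything about the walk presupposes
  a second vertex. The variable \<open>v\<close> below is universally quantified.
\<close>

locale walk_graph = graph +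
  assumes connected: "Digraph_Component.connected G"
    and nontrivial: "verts G \<noteq> {v}"
begin

abbreviation deg :: "'a \<Rightarrow> nat" where
  "deg x \<equiv> card (neighbours G x)"

lemma neighbours_sym: "y \<in> neighbours G x \<longleftrightarrow> x \<in> neighbours G y"
  using sym_arcs by (auto simp: neighbours_def dest: arcs_ends_symmetric)

lemma neighbours_irrefl: "x \<notin> neighbours G x"
  by (auto simp: neighbours_def dest: adj_not_same)

lemma neighbours_in_verts: "y \<in> neighbours G x \<Longrightarrow> y \<in> verts G"
  using neighbours_subset by blast

lemma finite_neighbours [simp]: "finite (neighbours G x)"
  using neighbours_subset finite_verts by (rule finite_subset)

lemma deg_pos: "x \<in> verts G \<Longrightarrow> deg x > 0"
  using neighbours_nonempty[OF connected _ nontrivial] by (simp add: card_gt_0_iff)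

lemma connected_induct [consumes 2, case_names base step]:
  assumes "x \<in> verts G" "y \<in> verts G" "P x"
    and "\<And>u w. u \<in> verts G \<Longrightarrow> P u \<Longrightarrow> w \<in> neighbours G u \<Longrightarrow> P w"
  shows "P y"
proof -
  have "x \<rightarrow>\<^sup>* y"
    using symmetric_connected_imp_strongly_connected[OF sym_arcs connected] assms(1,2) by auto
  then show ?thesis
  proof (induction rule: reachable_induct)
    case base
    show ?case by (fact assms(3))
  next
    case (step u w)
    then show ?case using assms(4)[of u w] by (auto simp: neighbours_def dest: adj_in_verts)
  qed
qed

lemma sum_neighbours_eq:
  fixes f :: "'a \<Rightarrow> 'c::comm_semiring_1"
  shows "(\<Sum>y\<in>neighbours G x. f y) = (\<Sum>y\<in>verts G. of_bool (y \<in> neighbours G x) * f y)"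
  using neighbours_subset[of x]
  by (simp add: of_bool_def if_distrib[of "\<lambda>c. c * _"] sum.If_cases Int_absorb1 Collect_mem_eq cong: if_cong)

lemma sum_neighbours_swap:
  fixes F :: "'a \<Rightarrow> 'a \<Rightarrow> 'c::comm_semiring_1"
  shows "(\<Sum>x\<in>verts G. \<Sum>y\<in>neighbours G x. F x y) = (\<Sum>x\<in>verts G. \<Sum>y\<in>neighbours G x. F y x)"
  unfolding sum_neighbours_eq by (subst sum.swap) (simp add: neighbours_sym)

section \<open>The graph Laplacian\<close>

definition laplacian :: "('a \<Rightarrow> real) \<Rightarrow> 'a \<Rightarrow> real" where
  "laplacian f x = (\<Sum>y\<in>neighbours G x. f x - f y)"

lemma laplacian_diff: "laplacian (\<lambda>x. f x - g x) x = laplacian f x - laplacian g x"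
  unfolding laplacian_def sum_subtractf[symmetric] by (intro sum.cong) auto

lemma laplacian_divide: "laplacian (\<lambda>x. f x / c) x = laplacian f x / c"
  unfolding laplacian_def sum_divide_distrib by (intro sum.cong) (auto simp: diff_divide_distrib)

text \<open>
  Both sides contain the same diagonal terms, and the mixed terms \<open>g x * f y\<close> range over ordered
  adjacent pairs, which are closed under exchange of the endpoints.
\<close>

lemma laplacian_self_adjoint:
  "(\<Sum>x\<in>verts G. g x * laplacian f x) = (\<Sum>x\<in>verts G. f x * laplacian g x)"
proof -
  have "(\<Sum>x\<in>verts G. g x * laplacian f x) =
      (\<Sum>x\<in>verts G. \<Sum>y\<in>neighbours G x. g x * f x) - (\<Sum>x\<in>verts G. \<Sum>y\<in>neighbours G x. g x * f y)" for f g
    by (simp only: laplacian_def sum_distrib_left sum_subtractf[symmetric] right_diff_distrib)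
  then show ?thesis
    using sum_neighbours_swap[of "\<lambda>x y. g x * f y"] by (simp add: mult.commute)
qed

lemma sum_laplacian: "(\<Sum>x\<in>verts G. laplacian f x) = 0"
  using laplacian_self_adjoint[of "\<lambda>_. 1" f] by (simp add: laplacian_def)

text \<open>
  At a maximum \<open>x \<noteq> a\<close> all terms \<open>f x - f y\<close> are nonnegative while their sum is at most zero, so
  all neighbours of \<open>x\<close> are maxima too. By connectedness the maximum spreads to \<open>a\<close>.
\<close>

lemma maximum_principle:
  assumes "a \<in> verts G" "y \<in> verts G"
    and sub: "\<And>x. x \<in> verts G \<Longrightarrow> x \<noteq> a \<Longrightarrow> laplacian f x \<le> 0"
  shows "f y \<le> f a"
proof (rule ccontr)
  assume less: "\<not> f y \<le> f a"
  define M where "M = Max (f ` verts G)"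
  have M: "f x \<le> M" if "x \<in> verts G" for x
    using that by (simp add: M_def)
  have "M \<in> f ` verts G" using assms(1) by (auto simp: M_def intro!: Max_in)
  then obtain z where z: "z \<in> verts G" "f z = M" by auto
  from z(1) assms(1) have "f a = M"
  proof (induction rule: connected_induct)
    case base
    show ?case by (fact z(2))
  next
    case (step u w)
    have "u \<noteq> a" using M[OF assms(2)] less step by auto
    then have "laplacian f u \<le> 0" using sub step by auto
    moreover have nonneg: "0 \<le> f u - f v" if "v \<in> neighbours G u" for v
      using M[OF neighbours_in_verts[OF that]] step by simp
    ultimately have "(\<Sum>v\<in>neighbours G u. f u - f v) = 0"
      unfolding laplacian_def by (intro antisym sum_nonneg) auto
    then show ?case
      using step nonneg by (subst (asm) sum_nonneg_eq_0_iff) auto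
  qed
  then show False using M[OF assms(2)] less by auto
qed

text \<open>
  The difference of two unit current potentials is harmonic everywhere; the maximum principle with
  every vertex in the role of \<open>a\<close> makes it constant, so the voltage is well defined.
\<close>

lemma effective_resistance_eqI:
  assumes "a \<in> verts G" "b \<in> verts G" "unit_current_potential G a b f"
  shows "effective_resistance G a b = f a - f b"
  unfolding effective_resistance_def
proof (rule the_equality)
  show "\<exists>h. unit_current_potential G a b h \<and> f a - f b = h a - h b" using assms by auto
next
  fix r assume "\<exists>h. unit_current_potential G a b h \<and> r = h a - h b"
  then obtain h where h: "unit_current_potential G a b h" "r = h a - h b" by auto
  have "laplacian (\<lambda>x. f x - h x) x = 0" if "x \<in> verts G" for x
    using assms(3) h(1) that unfolding laplacian_diff
    by (simp add: unit_current_potential_def laplacian_def)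
  then have "f x - h x \<le> f y - h y" if "x \<in> verts G" "y \<in> verts G" for x y
    using maximum_principle[OF that(2,1), of "\<lambda>x. f x - h x"] by auto
  then show "r = f a - f b"
    using assms(1,2) h(2) by (smt (verit))
qed

section \<open>Survival probabilities of the walk\<close>

definition transition :: "'a \<Rightarrow> 'a \<Rightarrow> ennreal" where
  "transition x y = of_bool (y \<in> neighbours G x) / of_nat (deg x)"

text \<open>
  For \<open>x \<noteq> b\<close> this is the probability that the walk from \<open>x\<close> avoids \<open>b\<close> up to time \<open>n\<close>: the
  \<open>n\<close>-th iterate, on the constant function one, of the transition operator killed at \<open>b\<close>. At
  \<open>x = b\<close> the value is not that probability.
\<close>

definition survival :: "'a \<Rightarrow> nat \<Rightarrow> 'a \<Rightarrow> ennreal" where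
  "survival b n = ((\<lambda>f x. \<Sum>y\<in>verts G - {b}. transition x y * f y) ^^ n) (\<lambda>_. 1)"

lemma survival_0 [simp]: "survival b 0 x = 1"
  by (simp add: survival_def)

lemma survival_Suc:
  "survival b (Suc n) x = (\<Sum>y\<in>verts G - {b}. transition x y * survival b n y)"
  by (simp add: survival_def)

lemma deg_times_transition:
  assumes "x \<in> verts G"
  shows "of_nat (deg x) * transition x y = of_bool (y \<in> neighbours G x)"
  using deg_pos[OF assms] unfolding transition_def
  by (auto simp: ennreal_times_divide of_nat_less_top intro!: ennreal_divide_self)

end

lemma sum_PiE_insert:
  assumes "k \<notin> S"
  shows "(\<Sum>x\<in>PiE (insert k S) W. F x) = (\<Sum>x\<in>PiE S W. \<Sum>y\<in>W k. F (x(k := y)))"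
proof -
  have "(\<Sum>x\<in>PiE (insert k S) W. F x) = (\<Sum>(y, x)\<in>W k \<times> PiE S W. F (x(k := y)))"
    unfolding PiE_insert_eq using inj_combinator[OF assms, of W]
    by (subst sum.reindex) (auto simp: case_prod_beta)
  also have "\<dots> = (\<Sum>y\<in>W k. \<Sum>x\<in>PiE S W. F (x(k := y)))"
    by (simp add: sum.cartesian_product)
  finally show ?thesis by (subst sum.swap)
qed

text \<open>
  Summing out the last vertex of the path replaces \<open>f\<close> by its image under the operator, while
  leaving the weight of the shorter path untouched; hence the induction has to be over all \<open>f\<close>.
\<close>

lemma sum_over_paths:
  fixes K :: "'a \<Rightarrow> 'a \<Rightarrow> 'c::comm_semiring_1"
  assumes "finite W"
  shows "(\<Sum>x\<in>PiE {..n} (\<lambda>_. W). of_bool (x 0 = a) * (\<Prod>i<n. K (x i) (x (Suc i))) * f (x n)) =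
    of_bool (a \<in> W) * ((\<lambda>f x. \<Sum>y\<in>W. K x y * f y) ^^ n) f a"
proof (induction n arbitrary: f)
  case 0
  have "(\<Sum>x\<in>PiE (insert 0 {}) (\<lambda>_. W). of_bool (x (0::nat) = a) * f (x 0)) = of_bool (a \<in> W) * f a"
    using assms
    by (subst sum_PiE_insert) (auto simp: of_bool_def if_distrib[of "\<lambda>c. c * _"] sum.delta' cong: if_cong)
  then show ?case by simp
next
  case (Suc n)
  let ?T = "\<lambda>f x. \<Sum>y\<in>W. K x y * f y"
  let ?w = "\<lambda>n x. of_bool (x 0 = a) * (\<Prod>i<n. K (x i) (x (Suc i)))"
  have "(\<Sum>x\<in>PiE {..Suc n} (\<lambda>_. W). ?w (Suc n) x * f (x (Suc n))) =
      (\<Sum>x\<in>PiE {..n} (\<lambda>_. W). \<Sum>y\<in>W. ?w (Suc n) (x(Suc n := y)) * f y)"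
    unfolding atMost_Suc by (subst sum_PiE_insert) auto
  also have "\<dots> = (\<Sum>x\<in>PiE {..n} (\<lambda>_. W). ?w n x * ?T f (x n))"
    by (intro sum.cong) (simp_all add: sum_distrib_left sum_distrib_right mult_ac)
  also have "\<dots> = of_bool (a \<in> W) * (?T ^^ n) (?T f) a" by (rule Suc.IH)
  finally show ?case by (simp only: funpow_Suc_right o_def)
qed

context walk_graph
begin

lemma sets_random_walk:
  assumes "a \<in> verts G"
  shows "sets (random_walk G a) = sets (PiM UNIV (\<lambda>_. count_space (verts G)))"
proof -
  interpret IT: Ionescu_Tulcea "walk_kernel G a" "\<lambda>_. count_space (verts G)"
    using Ionescu_Tulcea_walk_kernel[OF connected assms nontrivial] .
  show ?thesis by (simp add: random_walk_def)
qed

lemma random_walk_measurable [measurable]: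
  assumes "a \<in> verts G"
  shows "(\<lambda>X. X n) \<in> measurable (random_walk G a) (count_space (verts G))"
  using sets_random_walk[OF assms] by (subst measurable_cong_sets[OF _ refl]) auto

lemma random_walk_in_verts:
  assumes "a \<in> verts G" "X \<in> space (random_walk G a)"
  shows "X n \<in> verts G"
  using measurable_space[OF random_walk_measurable[OF assms(1)] assms(2), of n] by simp

text \<open>
  Avoiding \<open>b\<close> up to time \<open>n\<close> is the disjoint union of the finitely many cylinders given by the
  paths of length \<open>n\<close> in the complement of \<open>b\<close>. The factor \<open>of_bool (a \<noteq> b)\<close> comes from the
  starting vertex, which has to be one of those avoiding \<open>b\<close>.
\<close>

lemma emeasure_not_hit:
  assumes a: "a \<in> verts G"
  shows "emeasure (random_walk G a) {X \<in> space (random_walk G a). \<forall>i\<le>n. X i \<noteq> b} =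
    of_bool (a \<noteq> b) * survival b n a"
proof -
  let ?M = "random_walk G a" and ?W = "verts G - {b}"
  let ?P = "PiE {..n} (\<lambda>_. ?W)"
  let ?C = "\<lambda>x. {X \<in> space ?M. \<forall>i\<le>n. X i = x i}"
  have C: "?C x \<in> sets ?M" for x
  proof -
    have "{X \<in> space ?M. X i = x i} \<in> sets ?M" for i
    proof -
      have "{X \<in> space ?M. X i = x i} = (\<lambda>X. X i) -` ({x i} \<inter> verts G) \<inter> space ?M"
        using random_walk_in_verts[OF a] by auto
      then show ?thesis
        using measurable_sets[OF random_walk_measurable[OF a], of "{x i} \<inter> verts G"]
        by (simp del: vimage_Int)
    qed
    moreover have "?C x = (if n = n then \<Inter>i\<in>{..n}. {X \<in> space ?M. X i = x i} else {})"
      by auto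
    ultimately show ?thesis by auto
  qed
  have union: "{X \<in> space ?M. \<forall>i\<le>n. X i \<noteq> b} = (\<Union>x\<in>?P. ?C x)"
  proof (intro equalityI subsetI)
    fix X assume X: "X \<in> {X \<in> space ?M. \<forall>i\<le>n. X i \<noteq> b}"
    then have "restrict X {..n} \<in> ?P" "X \<in> ?C (restrict X {..n})"
      using random_walk_in_verts[OF a] by auto
    then show "X \<in> (\<Union>x\<in>?P. ?C x)" by blast
  qed auto
  have disjoint: "disjoint_family_on ?C ?P"
  proof (unfold disjoint_family_on_def, intro ballI impI)
    fix x y assume xy: "x \<in> ?P" "y \<in> ?P" "x \<noteq> y"
    then obtain i where "i \<le> n" "x i \<noteq> y i"
      using PiE_ext[of x "{..n}" "\<lambda>_. ?W" y] by blast
    then show "?C x \<inter> ?C y = {}" by auto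
  qed
  have "finite ?P" by (simp add: finite_PiE)
  then have "emeasure ?M {X \<in> space ?M. \<forall>i\<le>n. X i \<noteq> b} = (\<Sum>x\<in>?P. emeasure ?M (?C x))"
    unfolding union using C disjoint by (intro sum_emeasure[symmetric] image_subsetI)
  also have "\<dots> = (\<Sum>x\<in>?P. of_bool (x 0 = a) * (\<Prod>i<n. transition (x i) (x (Suc i))) * 1)"
    unfolding transition_def mult_1_right
    by (intro sum.cong refl emeasure_random_walk[OF connected a nontrivial]) (auto simp: PiE_iff)
  also have "\<dots> = of_bool (a \<in> ?W) * survival b n a"
    unfolding survival_def by (intro sum_over_paths) simp
  finally show ?thesis using a by simp
qed

lemma hitting_time_greater_iff: "enat n < hitting_time b X \<longleftrightarrow> (\<forall>i\<le>n. X i \<noteq> b)"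
proof -
  have "(\<forall>i\<le>n. X i \<noteq> b) \<longleftrightarrow> (\<forall>i\<in>{i. X i = b}. enat (Suc n) \<le> enat i)"
    by (auto simp: not_less_eq_eq)
  also have "\<dots> \<longleftrightarrow> enat (Suc n) \<le> hitting_time b X"
    unfolding hitting_time_def by (simp add: le_INF_iff)
  finally show ?thesis by (simp add: Suc_ile_eq)
qed

text \<open>
  The index set of the infimum in the definition depends on the trajectory; padding with infinite
  values turns it into an infimum over a fixed countable family of measurable functions.
\<close>

lemma measurable_hitting_time:
  assumes "a \<in> verts G"
  shows "hitting_time b \<in> measurable (random_walk G a) (count_space UNIV)"
proof -
  have "hitting_time b = (\<lambda>X. INF n. if X n = b then enat n else \<infinity>)"
  proof
    fix X
    show "hitting_time b X = (INF n. if X n = b then enat n else \<infinity>)"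
      unfolding hitting_time_def
    proof (intro antisym INF_greatest)
      fix n assume "n \<in> {n. X n = b}"
      then show "(INF n. if X n = b then enat n else \<infinity>) \<le> enat n"
        by (intro INF_lower2[of n]) auto
    qed (auto intro: INF_lower)
  qed
  moreover have "(\<lambda>X. INF n. if X n = b then enat n else \<infinity>)
      \<in> measurable (random_walk G a) (count_space UNIV)"
  proof (rule measurable_INF)
    fix n
    show "(\<lambda>X. if X n = b then enat n else \<infinity>) \<in> measurable (random_walk G a) (count_space UNIV)"
      by (rule measurable_compose[OF random_walk_measurable[OF assms, of n]]) simp
  qed simp
  ultimately show ?thesis by (simp only:)
qed

lemma expected_hitting_time_eq_suminf:
  assumes "a \<in> verts G"
  shows "expected_hitting_time G a b = of_bool (a \<noteq> b) * (\<Sum>n. survival b n a)"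
  unfolding expected_hitting_time_def nn_integral_enat_function[OF measurable_hitting_time[OF assms]]
    hitting_time_greater_iff emeasure_not_hit[OF assms]
  by (rule ennreal_suminf_cmult)

section \<open>Hitting times solve a Poisson equation\<close>

lemma expected_hitting_time_self: "b \<in> verts G \<Longrightarrow> expected_hitting_time G b b = 0"
  by (simp add: expected_hitting_time_eq_suminf)

text \<open>
  The recursion for the survival probabilities, summed over time. It is stated multiplied by the
  degree, which is the form that becomes a Poisson equation, and in the extended reals, since
  finiteness of the expectations is derived from it.
\<close>

lemma expected_hitting_time_first_step:
  assumes x: "x \<in> verts G" "x \<noteq> b" and b: "b \<in> verts G"
  shows "of_nat (deg x) * expected_hitting_time G x b =
    of_nat (deg x) + (\<Sum>y\<in>neighbours G x. expected_hitting_time G y b)"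
proof -
  let ?E = "\<lambda>y. expected_hitting_time G y b" and ?W = "verts G - {b}"
  have "?E x = survival b 0 x + (\<Sum>n. survival b (Suc n) x)"
    using x suminf_offset[of "\<lambda>n. survival b n x" 1, OF summableI]
    by (simp add: expected_hitting_time_eq_suminf add.commute)
  also have "(\<Sum>n. survival b (Suc n) x) = (\<Sum>y\<in>?W. \<Sum>n. transition x y * survival b n y)"
    unfolding survival_Suc by (rule suminf_sum) (rule summableI)
  also have "\<dots> = (\<Sum>y\<in>?W. transition x y * ?E y)"
    by (intro sum.cong) (auto simp: expected_hitting_time_eq_suminf ennreal_suminf_cmult)
  finally have "of_nat (deg x) * ?E x =
      of_nat (deg x) + (\<Sum>y\<in>?W. of_nat (deg x) * transition x y * ?E y)"
    by (simp add: distrib_left sum_distrib_left mult.assoc)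
  also have "(\<Sum>y\<in>?W. of_nat (deg x) * transition x y * ?E y) = (\<Sum>y\<in>verts G. of_bool (y \<in> neighbours G x) * ?E y)"
    unfolding deg_times_transition[OF x(1)]
    using b by (intro sum.mono_neutral_left) (auto simp: expected_hitting_time_self)
  finally show ?thesis unfolding sum_neighbours_eq .
qed

text \<open>
  The degree is a reversible measure of the walk, so under one killed step the mass of the
  degree-weighted survival function decreases exactly by what is lost at the neighbours of \<open>b\<close>.
\<close>

lemma sum_survival_neighbours:
  assumes b: "b \<in> verts G"
  shows "(\<Sum>x\<in>verts G - {b}. of_nat (deg x) * survival b n x) =
    (\<Sum>x\<in>neighbours G b. survival b n x) + (\<Sum>x\<in>verts G - {b}. of_nat (deg x) * survival b (Suc n) x)"
proof -
  let ?W = "verts G - {b}"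
  have "(\<Sum>x\<in>?W. of_nat (deg x) * survival b (Suc n) x) =
      (\<Sum>x\<in>?W. \<Sum>y\<in>?W. of_bool (y \<in> neighbours G x) * survival b n y)"
    unfolding survival_Suc sum_distrib_left mult.assoc[symmetric]
    by (intro sum.cong refl) (auto simp: deg_times_transition)
  also have "\<dots> = (\<Sum>y\<in>?W. of_nat (card (neighbours G y - {b})) * survival b n y)"
  proof (subst sum.swap, intro sum.cong refl)
    fix y
    have "neighbours G y - {b} = ?W \<inter> {x. y \<in> neighbours G x}"
      using neighbours_sym neighbours_in_verts by blast
    then have "(\<Sum>x\<in>?W. of_bool (y \<in> neighbours G x)) = (of_nat (card (neighbours G y - {b})) :: ennreal)"
      by simp
    then show "(\<Sum>x\<in>?W. of_bool (y \<in> neighbours G x) * survival b n y) =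
        of_nat (card (neighbours G y - {b})) * survival b n y"
      by (simp add: sum_distrib_right[symmetric])
  qed
  finally have *: "(\<Sum>x\<in>?W. of_nat (deg x) * survival b (Suc n) x) =
      (\<Sum>y\<in>?W. of_nat (card (neighbours G y - {b})) * survival b n y)" .
  have "neighbours G b = ?W \<inter> {x. b \<in> neighbours G x}"
    using neighbours_sym neighbours_in_verts neighbours_irrefl by blast
  then have "(\<Sum>x\<in>neighbours G b. survival b n x) = (\<Sum>x\<in>?W \<inter> {x. b \<in> neighbours G x}. survival b n x)"
    by (rule arg_cong)
  also have "\<dots> = (\<Sum>x\<in>?W. of_bool (b \<in> neighbours G x) * survival b n x)"
    by simp
  finally have "(\<Sum>x\<in>neighbours G b. survival b n x) =
      (\<Sum>x\<in>?W. of_bool (b \<in> neighbours G x) * survival b n x)" .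
  moreover have "of_nat (deg x) * survival b n x = of_bool (b \<in> neighbours G x) * survival b n x +
      of_nat (card (neighbours G x - {b})) * survival b n x" for x
  proof (cases "b \<in> neighbours G x")
    case True
    then have "deg x = Suc (card (neighbours G x - {b}))" by (intro card.remove) simp_all
    then show ?thesis using True by (simp only: of_nat_Suc distrib_right of_bool_eq mult_1_left simp_thms)
  qed simp
  ultimately show ?thesis unfolding * by (simp add: sum.distrib)
qed

text \<open>
  The losses of the preceding lemma telescope, so in total they are at most the initial mass, the sum
  of the degrees. The total loss is the sum of the expected hitting times of \<open>b\<close> from its
  neighbours.
\<close>

lemma expected_hitting_time_neighbour_finite:
  assumes b: "b \<in> verts G" and x: "x \<in> neighbours G b"
  shows "expected_hitting_time G x b < \<infinity>"
proof -
  let ?D = "\<lambda>n. \<Sum>x\<in>verts G - {b}. of_nat (deg x) * survival b n x"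
  have telescope: "(\<Sum>n<k. \<Sum>x\<in>neighbours G b. survival b n x) + ?D k = ?D 0" for k
  proof (induction k)
    case (Suc k)
    then show ?case using sum_survival_neighbours[OF b, of k] by (simp add: add.assoc)
  qed simp
  have "(\<Sum>n<k. \<Sum>x\<in>neighbours G b. survival b n x) \<le> ?D 0" for k
    unfolding telescope[of k, symmetric] by (rule add_increasing2) simp_all
  then have "(\<Sum>n. \<Sum>x\<in>neighbours G b. survival b n x) \<le> ?D 0"
    by (intro suminf_le_const summableI)
  moreover have "expected_hitting_time G x b \<le> (\<Sum>n. \<Sum>x\<in>neighbours G b. survival b n x)"
  proof -
    have "expected_hitting_time G x b \<le> (\<Sum>n. survival b n x)"
      using neighbours_in_verts[OF x] by (simp add: expected_hitting_time_eq_suminf)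
    also have "\<dots> \<le> (\<Sum>n. \<Sum>x\<in>neighbours G b. survival b n x)"
      using x by (intro suminf_le summableI member_le_sum) auto
    finally show ?thesis .
  qed
  moreover have "?D 0 < \<infinity>" by (simp add: of_nat_less_top)
  ultimately show ?thesis by (meson le_less_trans)
qed

text \<open>
  Finiteness spreads away from \<open>b\<close>: if \<open>E\<^sub>u T\<^sub>b\<close> is finite and \<open>u \<noteq> b\<close>, then so is every term of the
  first-step equation at \<open>u\<close>.
\<close>

lemma expected_hitting_time_finite:
  assumes "b \<in> verts G" "x \<in> verts G"
  shows "expected_hitting_time G x b < \<infinity>"
  using assms
proof (induction rule: connected_induct)
  case base
  show ?case using assms(1) by (simp add: expected_hitting_time_self)
next
  case (step u w)
  show ?case
  proof (cases "u = b")
    case True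
    then show ?thesis using expected_hitting_time_neighbour_finite step by blast
  next
    case False
    have "expected_hitting_time G w b \<le> (\<Sum>y\<in>neighbours G u. expected_hitting_time G y b)"
      using step by (intro member_le_sum) auto
    also have "\<dots> \<le> of_nat (deg u) * expected_hitting_time G u b"
      using expected_hitting_time_first_step[OF step.hyps(1) False assms(1)] by simp
    also have "\<dots> < \<infinity>"
      using step by (simp add: ennreal_mult_less_top of_nat_less_top)
    finally show ?thesis .
  qed
qed

section \<open>Real-valued hitting times and the commute time identity\<close>

definition hit :: "'a \<Rightarrow> 'a \<Rightarrow> real" where
  "hit x b = enn2real (expected_hitting_time G x b)"

definition vol :: "'a set \<Rightarrow> real" where
  "vol A = (\<Sum>x\<in>A. real (deg x))"

lemma hit_nonneg: "0 \<le> hit x b"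
  by (simp add: hit_def)

lemma hit_self: "b \<in> verts G \<Longrightarrow> hit b b = 0"
  by (simp add: hit_def expected_hitting_time_self)

lemma laplacian_hit_other:
  assumes "x \<in> verts G" "b \<in> verts G" "x \<noteq> b"
  shows "laplacian (\<lambda>y. hit y b) x = deg x"
proof -
  have E: "expected_hitting_time G y b = ennreal (hit y b)" if "y \<in> verts G" for y
    using expected_hitting_time_finite[OF assms(2) that] by (simp add: hit_def)
  have "(\<Sum>y\<in>neighbours G x. expected_hitting_time G y b) = (\<Sum>y\<in>neighbours G x. ennreal (hit y b))"
    by (intro sum.cong) (auto simp: E neighbours_in_verts)
  then have "ennreal (real (deg x) * hit x b) = ennreal (real (deg x) + (\<Sum>y\<in>neighbours G x. hit y b))"
    using expected_hitting_time_first_step[OF assms(1,3,2)] assms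
    by (simp add: E ennreal_of_nat_eq_real_of_nat ennreal_mult ennreal_plus hit_nonneg sum_nonneg)
  then have "real (deg x) * hit x b = real (deg x) + (\<Sum>y\<in>neighbours G x. hit y b)"
    by (subst (asm) ennreal_inj) (auto simp: hit_nonneg intro!: add_nonneg_nonneg sum_nonneg mult_nonneg_nonneg)
  then show ?thesis by (simp add: laplacian_def sum_subtractf)
qed

text \<open>The value at \<open>b\<close> is forced by the fact that a Laplacian sums to zero.\<close>

lemma laplacian_hit:
  assumes "x \<in> verts G" "b \<in> verts G"
  shows "laplacian (\<lambda>y. hit y b) x = deg x - vol (verts G) * of_bool (x = b)"
proof (cases "x = b")
  case True
  have "laplacian (\<lambda>y. hit y b) b = - (\<Sum>x\<in>verts G - {b}. laplacian (\<lambda>y. hit y b) x)"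
    using sum_laplacian[of "\<lambda>y. hit y b"] assms(2) by (simp add: sum.remove)
  also have "\<dots> = - (\<Sum>x\<in>verts G - {b}. real (deg x))"
    using laplacian_hit_other[OF _ assms(2)] by simp
  finally show ?thesis using True assms(2) by (simp add: vol_def sum.remove)
qed (use laplacian_hit_other assms in simp)

lemma hit_pos:
  assumes "x \<in> verts G" "b \<in> verts G" "x \<noteq> b"
  shows "hit x b > 0"
proof -
  have "0 < laplacian (\<lambda>y. hit y b) x"
    using laplacian_hit_other[OF assms] deg_pos[OF assms(1)] by simp
  also have "\<dots> \<le> deg x * hit x b"
    by (simp add: laplacian_def sum_subtractf hit_nonneg sum_nonneg)
  finally show ?thesis by (simp add: zero_less_mult_iff)
qed

lemma vol_pos: "vol (verts G) > 0"
proof -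
  obtain v where "v \<in> verts G" using connected by (auto simp: connected_conv)
  then show ?thesis unfolding vol_def using deg_pos by (intro sum_pos) auto
qed

text \<open>
  In the difference of the Poisson equations for the targets \<open>b\<close> and \<open>a\<close> the degrees cancel, and
  only a source at \<open>a\<close> and a sink at \<open>b\<close>, of strength \<open>vol (verts G)\<close>, are left.
\<close>

lemma effective_resistance_eq_commute_time:
  assumes "a \<in> verts G" "b \<in> verts G"
  shows "effective_resistance G a b = (hit a b + hit b a) / vol (verts G)"
proof -
  let ?f = "\<lambda>x. (hit x b - hit x a) / vol (verts G)"
  have "laplacian ?f x = of_bool (x = a) - of_bool (x = b)" if "x \<in> verts G" for x
    using assms that vol_pos
    by (simp add: laplacian_divide laplacian_diff laplacian_hit field_simps)
  then have "unit_current_potential G a b ?f"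
    by (simp add: unit_current_potential_def laplacian_def)
  then have "effective_resistance G a b = ?f a - ?f b" by (rule effective_resistance_eqI[OF assms])
  then show ?thesis using assms by (simp add: hit_self diff_divide_distrib add_divide_distrib)
qed

end

section \<open>Highly symmetric graphs\<close>

locale highly_symmetric_graph = walk_graph +
  assumes highly_symmetric: "highly_symmetric G"
begin

lemma hit_commute: "a \<in> verts G \<Longrightarrow> b \<in> verts G \<Longrightarrow> hit a b = hit b a"
  using highly_symmetric by (simp add: hit_def highly_symmetric_def)

text \<open>
  By symmetry the resistance to \<open>b\<close> is proportional to the hitting time of \<open>b\<close>, so the latter is
  constant on the neighbours of \<open>b\<close> and can be read off from the Poisson equation at \<open>b\<close>.
\<close>

lemma resistance_regular_imp_hit_eq:
  assumes "resistance_regular G b" "b \<in> verts G" "y \<in> neighbours G b"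
  shows "deg b * (hit y b + 1) = vol (verts G)"
proof -
  have R: "effective_resistance G b z = 2 * hit z b / vol (verts G)" if "z \<in> neighbours G b" for z
    using effective_resistance_eq_commute_time[OF assms(2) neighbours_in_verts[OF that]]
      hit_commute[OF assms(2) neighbours_in_verts[OF that]] by simp
  have "hit z b = hit y b" if "z \<in> neighbours G b" for z
  proof -
    have "effective_resistance G b z = effective_resistance G b y"
      using assms(1,3) that unfolding resistance_regular_def by blast
    then show ?thesis using R[OF that] R[OF assms(3)] vol_pos by simp
  qed
  then have "laplacian (\<lambda>z. hit z b) b = - (deg b * hit y b)"
    using assms(2) by (simp add: laplacian_def sum_subtractf hit_self)
  then show ?thesis using laplacian_hit[OF assms(2,2)] by (simp add: distrib_left)
qed

lemma resistance_regular_imp_regular: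
  assumes "\<forall>v\<in>verts G. resistance_regular G v"
  shows "regular G"
proof -
  have deg_eq: "deg x = deg y" if "x \<in> verts G" "y \<in> neighbours G x" for x y
  proof -
    have y: "y \<in> verts G" using that neighbours_in_verts by blast
    have "deg x * (hit y x + 1) = deg y * (hit x y + 1)"
      using resistance_regular_imp_hit_eq[of x y] resistance_regular_imp_hit_eq[of y x] assms that y
      by (metis neighbours_sym)
    moreover have "hit y x = hit x y" using that y by (intro hit_commute)
    ultimately show ?thesis using hit_nonneg[of x y] by simp
  qed
  obtain v where v: "v \<in> verts G" using connected by (auto simp: connected_conv)
  have "deg w = deg v" if "w \<in> verts G" for w
    using v that
  proof (induction rule: connected_induct)
    case (step u w)
    then show ?case using deg_eq[of u w] by simp
  qed simp
  then show ?thesis unfolding regular_def by blast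
qed

text \<open>
  The idea behind the inequality: for \<open>a \<in> A\<close>, the walk from \<open>a\<close> to \<open>v\<close> stays in \<open>A\<close> before it
  hits \<open>v\<close>, whereas the walk from \<open>v\<close> to \<open>a\<close> loses time in the rest of the graph. The two expected
  times can only agree if that rest is not too large.
\<close>

lemma vol_le_twice_side:
  assumes v: "v \<in> verts G" "v \<notin> A" and A: "A \<subseteq> verts G" "A \<noteq> {}"
    and closed: "\<And>x y. x \<in> A \<Longrightarrow> y \<in> neighbours G x \<Longrightarrow> y \<in> insert v A"
  shows "vol (verts G) \<le> 2 * vol A"
proof -
  obtain a where a: "a \<in> A" "a \<in> verts G" "a \<noteq> v" using v A by blast
  define t where "t = hit a v"
  \<comment> \<open>The potential of a current from \<open>a\<close> to \<open>v\<close>, tested against \<open>h\<^sub>v\<close> restricted to \<open>A\<close>.\<close>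
  define g where "g x = hit x v - hit x a" for x
  define u where "u x = hit x v * of_bool (x \<in> A)" for x
  have t_pos: "t > 0" unfolding t_def using hit_pos a v by blast
  have g: "laplacian g x = vol (verts G) * (of_bool (x = a) - of_bool (x = v))" if "x \<in> verts G" for x
    using that a v unfolding g_def by (simp add: laplacian_diff laplacian_hit algebra_simps)
  \<comment> \<open>Symmetry of the hitting times enters through the value at \<open>v\<close>.\<close>
  have g_a: "g a = t" and g_v: "g v = - t"
    using a v hit_commute[of a v] by (simp_all add: g_def t_def hit_self)
  have g_le: "g x \<le> t" if "x \<in> verts G" for x
    unfolding g_a[symmetric]
  proof (rule maximum_principle[OF a(2) that])
    fix z assume "z \<in> verts G" "z \<noteq> a"
    then show "laplacian g z \<le> 0" using g[of z] vol_pos by simp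
  qed
  have u_A: "laplacian u x = deg x" if x: "x \<in> A" for x
  proof -
    have "u y = hit y v" if "y \<in> neighbours G x" for y
      using closed[OF x that] v by (auto simp: u_def hit_self)
    moreover have "u x = hit x v" using x by (simp add: u_def)
    ultimately have "laplacian u x = laplacian (\<lambda>y. hit y v) x"
      by (simp add: laplacian_def)
    then show ?thesis using laplacian_hit_other[of x v] x v A by auto
  qed
  have u_B: "laplacian u x = 0" if "x \<in> verts G - A - {v}" for x
  proof -
    have "u y = 0" if "y \<in> insert x (neighbours G x)" for y
      using that \<open>x \<in> verts G - A - {v}\<close> closed[of y x] neighbours_sym[of x y] by (auto simp: u_def)
    then show ?thesis by (simp add: laplacian_def)
  qed
  have split: "(\<Sum>x\<in>verts G. f x) = (\<Sum>x\<in>A. f x) + f v" if "\<And>x. x \<in> verts G - A - {v} \<Longrightarrow> f x = 0"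
    for f :: "'a \<Rightarrow> real"
  proof -
    have "(\<Sum>x\<in>verts G. f x) = (\<Sum>x\<in>insert v A. f x)"
      using v A that by (intro sum.mono_neutral_right) auto
    then show ?thesis using v A finite_subset[OF A(1)] by simp
  qed
  have u_v: "laplacian u v = - vol A"
    using sum_laplacian[of u] split[of "laplacian u"] u_A u_B by (simp add: vol_def)
  have "(\<Sum>x\<in>verts G. u x * laplacian g x) =
      (\<Sum>x\<in>verts G. vol (verts G) * u x * of_bool (x = a)) - (\<Sum>x\<in>verts G. vol (verts G) * u x * of_bool (x = v))"
    unfolding sum_subtractf[symmetric] by (intro sum.cong) (simp_all add: g algebra_simps)
  also have "\<dots> = vol (verts G) * t"
    using a v by (simp add: u_def t_def)
  finally have "vol (verts G) * t = (\<Sum>x\<in>verts G. u x * laplacian g x)" by (rule sym)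
  also have "\<dots> = (\<Sum>x\<in>verts G. g x * laplacian u x)"
    by (rule laplacian_self_adjoint)
  also have "\<dots> = (\<Sum>x\<in>A. g x * deg x) + t * vol A"
    by (subst split) (simp_all add: u_A u_B u_v g_v)
  also have "(\<Sum>x\<in>A. g x * deg x) \<le> (\<Sum>x\<in>A. t * deg x)"
    using A g_le by (intro sum_mono mult_right_mono) auto
  also have "\<dots> + t * vol A = (2 * vol A) * t"
    by (simp add: vol_def flip: sum_distrib_left)
  finally show ?thesis using t_pos by simp
qed

text \<open>
  Both \<open>A\<close> and \<open>B\<close> would have to carry half of the volume, which leaves none for \<open>v\<close>. That \<open>B\<close>
  can be left only through \<open>v\<close> is inherited from \<open>A\<close>, for adjacency is symmetric.
\<close>

lemma no_separation:
  assumes "v \<in> verts G" "A \<noteq> {}" "B \<noteq> {}" "A \<inter> B = {}" "verts G - {v} = A \<union> B"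
    and A: "\<And>x y. x \<in> A \<Longrightarrow> y \<in> neighbours G x \<Longrightarrow> y \<in> insert v A"
  shows False
proof -
  have B: "y \<in> insert v B" if "x \<in> B" "y \<in> neighbours G x" for x y
    using that A[of y x] assms(4,5) neighbours_in_verts[OF that(2)] neighbours_sym[of x y] by auto
  have fin: "finite A" "finite B"
    using assms(5) finite_verts by (metis finite_Diff finite_Un)+
  have "vol (verts G) = vol (A \<union> B) + deg v"
    using assms(1) by (simp add: vol_def sum.remove[of _ v] flip: assms(5))
  also have "vol (A \<union> B) = vol A + vol B"
    unfolding vol_def using fin assms(4) by (rule sum.union_disjoint)
  finally have "vol (verts G) = vol A + vol B + deg v" .
  moreover have "vol (verts G) \<le> 2 * vol A" "vol (verts G) \<le> 2 * vol B"
    using assms(1-3,5) A B by (intro vol_le_twice_side[of v]; blast)+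
  ultimately show False using deg_pos[OF assms(1)] by simp
qed

lemma no_cut_vertex: "\<not> cut_vertex G v"
proof
  assume cut: "cut_vertex G v"
  let ?H = "del_vert v"
  have v: "v \<in> verts G" and H: "\<not> Digraph_Component.connected ?H" and ne: "verts ?H \<noteq> {}"
    using cut by (auto simp: cut_vertex_def verts_del_vert)
  interpret H: sym_digraph ?H
  proof (rule wf_digraph.sym_digraphI[OF wf_digraph_del_vert])
    show "symmetric ?H"
      using sym_arcs unfolding symmetric_conv by (simp add: del_vert_simps) metis
  qed
  from H.not_connectedE[OF H ne] obtain A where
    A: "A \<subseteq> verts ?H" "A \<noteq> {}" "A \<noteq> verts ?H" "\<And>x y. x \<in> A \<Longrightarrow> x \<rightarrow>\<^bsub>?H\<^esub> y \<Longrightarrow> y \<in> A" by blast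
  show False
  proof (rule no_separation[OF v, of A "verts G - {v} - A"])
    fix x y assume xy: "x \<in> A" "y \<in> neighbours G x"
    then have "x \<rightarrow>\<^bsub>?H\<^esub> y" if "y \<noteq> v"
      using that A(1) by (auto simp: neighbours_def arcs_ends_conv del_vert_simps)
    then show "y \<in> insert v A" using A(4) xy by blast
  qed (use A in \<open>auto simp: verts_del_vert\<close>)
qed

text \<open>
  Removing the edge leaves a closed set \<open>A\<close>, and the edge \<open>{u, w}\<close> is the only one that leaves \<open>A\<close>.
  If \<open>A\<close> contained more than \<open>u\<close>, then \<open>u\<close> would separate the graph; if the complement of \<open>A\<close>
  contained more than \<open>w\<close>, then \<open>w\<close> would.
\<close>

lemma cut_edge_imp_two_vertices:
  assumes "cut_edge G e"
  obtains u w where "u \<noteq> w" "verts G = {u, w}" "e = {u, w}"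
proof -
  let ?H = "remove_edge G e"
  have H: "\<not> Digraph_Component.connected ?H"
    using assms by (simp add: cut_edge_def)
  have H_simps: "verts ?H = verts G" "tail ?H = tail G" "head ?H = head G"
    "arcs ?H = {x \<in> arcs G. {tail G x, head G x} \<noteq> e}"
    by (simp_all add: remove_edge_def)
  interpret H: sym_digraph ?H
  proof
    show "symmetric ?H"
      unfolding symmetric_conv
    proof
      fix x assume x: "x \<in> arcs ?H"
      then obtain y where "y \<in> arcs G" "tail G x = head G y" "head G x = tail G y"
        using sym_arcs unfolding symmetric_conv H_simps by blast
      then show "\<exists>y\<in>arcs ?H. tail ?H x = head ?H y \<and> head ?H x = tail ?H y"
        using x by (auto simp: H_simps doubleton_eq_iff)
    qed
  qed (auto simp: H_simps)
  have ne: "verts ?H \<noteq> {}" using connected by (auto simp: connected_conv H_simps)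
  from H.not_connectedE[OF H ne] obtain A where
    A: "A \<subseteq> verts G" "A \<noteq> {}" "A \<noteq> verts G" "\<And>x y. x \<in> A \<Longrightarrow> x \<rightarrow>\<^bsub>?H\<^esub> y \<Longrightarrow> y \<in> A"
    by (auto simp: H_simps)
  have crossing: "{x, y} = e" if "x \<in> A" "y \<in> neighbours G x" "y \<notin> A" for x y
    using that A(4)[of x y] by (auto simp: neighbours_def arcs_ends_conv H_simps)
  obtain p q where pq: "p \<in> A" "q \<in> verts G" "q \<notin> A" using A by blast
  have "\<exists>u\<in>A. \<exists>w\<in>neighbours G u. w \<notin> A"
  proof (rule ccontr)
    assume "\<not> ?thesis"
    moreover have "p \<in> verts G" using pq A by auto
    ultimately have "q \<in> A"
      using connected_induct[of p q "\<lambda>x. x \<in> A"] pq by blast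
    then show False using pq by simp
  qed
  then obtain u w where uw: "u \<in> A" "w \<in> neighbours G u" "w \<notin> A" by blast
  have e: "e = {u, w}" using crossing uw by auto
  have ends: "x = u \<and> y = w" if "x \<in> A" "y \<in> neighbours G x" "y \<notin> A" for x y
    using crossing[OF that] that uw e by (auto simp: doubleton_eq_iff)
  have w: "w \<in> verts G" using uw neighbours_in_verts by blast
  have "A = {u}"
  proof (rule ccontr)
    assume "A \<noteq> {u}"
    show False
    proof (rule no_separation[of u "A - {u}" "verts G - A"])
      fix x y assume "x \<in> A - {u}" "y \<in> neighbours G x"
      then show "y \<in> insert u (A - {u})" using ends[of x y] by auto
    qed (use uw w A \<open>A \<noteq> {u}\<close> in auto)
  qed
  moreover have "verts G - A = {w}"
  proof (rule ccontr)
    assume "verts G - A \<noteq> {w}"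
    show False
    proof (rule no_separation[of w A "verts G - A - {w}"])
      fix x y assume "x \<in> A" "y \<in> neighbours G x"
      then show "y \<in> insert w A" using ends[of x y] by auto
    qed (use uw w A \<open>verts G - A \<noteq> {w}\<close> in auto)
  qed
  ultimately show thesis using that[of u w] uw e A by auto
qed

text \<open>The graph is a single edge, so what remains after its removal are two isolated vertices.\<close>

lemma cut_edge_components:
  assumes "cut_edge G e"
  shows "\<exists>C D. graph_components (remove_edge G e) = {C, D} \<and> C \<noteq> D \<and> card (edges C) = card (edges D)"
proof -
  let ?H = "remove_edge G e"
  from assms obtain u w where uw: "u \<noteq> w" "verts G = {u, w}" "e = {u, w}"
    by (rule cut_edge_imp_two_vertices)
  have "{tail G x, head G x} = e" if "x \<in> arcs G" for x
    using that tail_in_verts[OF that] head_in_verts[OF that] no_loops[OF that] uw by auto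
  then have no_arcs: "arcs ?H = {}" by (auto simp: remove_edge_def)
  interpret H: wf_digraph ?H by standard (simp_all add: no_arcs)
  have verts: "verts ?H = {u, w}" using uw by (simp add: remove_edge_def)
  have reach: "x \<rightarrow>\<^sup>*\<^bsub>?H\<^esub> y \<longleftrightarrow> x = y \<and> x \<in> {u, w}" for x y
  proof -
    have "arcs_ends ?H = {}" by (simp add: arcs_ends_def no_arcs)
    then show ?thesis by (auto simp: H.reachable_conv verts)
  qed
  have "H.sccs_verts = {{u}, {w}}"
  proof (intro equalityI subsetI)
    fix S assume "S \<in> H.sccs_verts"
    then show "S \<in> {{u}, {w}}" by (auto simp: H.sccs_verts_def reach)
  qed (auto simp: H.sccs_verts_def reach)
  then have "H.sccs = {?H \<restriction> {u}, ?H \<restriction> {w}}"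
    by (simp add: H.sccs_conv_sccs_verts)
  moreover have "?H \<restriction> {u} \<noteq> ?H \<restriction> {w}"
    using uw(1) by (metis induce_subgraph_verts singleton_inject)
  moreover have "edges (?H \<restriction> S) = {}" for S
    by (simp add: edges_def no_arcs induce_subgraph_arcs)
  ultimately show ?thesis by (intro exI[of _ "?H \<restriction> {u}"] exI[of _ "?H \<restriction> {w}"]) simp
qed

lemma cut_edge_unique:
  assumes "cut_edge G e" "cut_edge G f"
  shows "e = f"
  using cut_edge_imp_two_vertices[OF assms(1)] cut_edge_imp_two_vertices[OF assms(2)] by metis

end

theorem proposition4:
  fixes G :: "('a, 'b) pre_digraph"
  assumes "graph G" and "Digraph_Component.connected G" and "highly_symmetric G"
  shows "((\<forall>v\<in>verts G. resistance_regular G v) \<longrightarrow> regular G)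
    \<and> \<not> (\<exists>v. cut_vertex G v \<and> resistance_regular G v)
    \<and> (\<forall>e. cut_edge G e \<longrightarrow>
         (\<exists>C D. graph_components (remove_edge G e) = {C, D} \<and> C \<noteq> D \<and> card (edges C) = card (edges D)))
    \<and> \<not> (\<exists>e f. cut_edge G e \<and> cut_edge G f \<and> e \<noteq> f)"
proof (cases "\<exists>v. verts G = {v}")
  case True
  interpret graph G by fact
  obtain v where v: "verts G = {v}" using True by blast
  have "arcs G = {}" using tail_in_verts head_in_verts no_loops v by force
  then show ?thesis
    by (auto simp: v regular_def cut_vertex_def cut_edge_def edges_def)
next
  case False
  interpret highly_symmetric_graph G
    using assms False
    by (intro highly_symmetric_graph.intro walk_graph.intro walk_graph_axioms.intro
      highly_symmetric_graph_axioms.intro) auto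
  show ?thesis
    using resistance_regular_imp_regular no_cut_vertex cut_edge_components cut_edge_unique by blast
qed

end
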